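(* Let $m\in\mathbb{N}$ and $d\ge2$, and let $\eta=(0,\dots,0,-1)\in\mathbb{R}^d$. There are constants $c_1,c_2>0$ depending only on $m$ and $d$ such that for every $\varepsilon>0$ the function $$\mathcal{F}^*_{\varepsilon,m}(x):=\frac{2^{2m-2}(d/2)_{m-1}}{m!}\,\frac{\varepsilon^{2m-1}}{|x-\varepsilon\eta|^{2m+d-2}},\quad x\in\mathbb{R}^{d-1},$$ has the following properties: $$0<\mathcal{F}^*_{\varepsilon,m}(x)\le\frac{c_1\varepsilon^{-d+1}}{(1+\varepsilon^{-1}|x|)^{2m+d-2}}\quad\text{for all }x\in\mathbb{R}^{d-1},$$ and $$\int_{\mathbb{R}^{d-1}}\mathcal{F}^*_{\varepsilon,m}(x)\,dx_1\dots dx_{d-1}\ge c_2>0.$$ Furthermore, $\mathcal{F}^*_{\varepsilon,m}$ is the restriction to $\mathbb{R}^{d-1}$ of the harmonic function $H^*_{\varepsilon,m}$, defined on $\mathbb{R}^d\setminus\{\varepsilon\eta\}$ by $$H^*_{\varepsilon,m}(x)=\sum_{\ell=1}^m\frac{(-1)^\ell2^{\ell-1}(2m-\ell-1)!}{(\ell-1)!\,m!\,(m-\ell)!\,(d-2)}\,\varepsilon^{\ell-1}\,\partial_d^\ell\frac{1}{|x-\varepsilon\eta|^{d-2}}\quad\text{if }d\ge3,$$ $$H^*_{\varepsilon,m}(x)=\sum_{\ell=1}^m\frac{(-1)^\ell2^{\ell-1}(2m-\ell-1)!}{(\ell-1)!\,m!\,(m-\ell)!}\,\varepsilon^{\ell-1}\,\partial_d^\ell\ln\frac{1}{|x-\varepsilon\eta|}\quad\text{if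 }d=2.$$
   Context: $|\cdot|$ is the Euclidean norm on $\mathbb{R}^d$. $\mathbb{R}^{d-1}$ is identified with the subspace $\{x\in\mathbb{R}^d: x=(x_1,\dots,x_{d-1},0)\}$ of $\mathbb{R}^d$. $\partial_d$ is the partial derivative with respect to $x_d$. $(u)_0:=1$, $(u)_k:=u(u+1)\cdots(u+k-1)$ is the Pochhammer symbol. *)

theory Defs
  imports "HOL-Analysis.Analysis"
begin

text \<open>
  For \<open>d \<ge> 2\<close>, \<open>\<real>\<^sup>d\<close> is modelled as \<open>(real ^ 'n) \<times> real\<close> with \<open>CARD('n) = d - 1\<close>: the second component
  is the last coordinate \<open>x\<^sub>d\<close>, the norm of the product type is the Euclidean norm, and \<open>\<real>\<^sup>d\<^sup>-\<^sup>1\<close>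
  is \<open>real ^ 'n\<close>, identified with the subspace of the points \<open>(x, 0)\<close>.
\<close>

definition partial_deriv :: "'a::euclidean_space \<Rightarrow> ('a \<Rightarrow> real) \<Rightarrow> 'a \<Rightarrow> real" where
  "partial_deriv b u x = deriv (\<lambda>t. u (x + t *\<^sub>R b)) 0"

definition has_partial_derivs_on :: "'a::euclidean_space set \<Rightarrow> ('a \<Rightarrow> real) \<Rightarrow> bool" where
  "has_partial_derivs_on S u \<longleftrightarrow>
     (\<forall>b\<in>Basis. \<forall>x\<in>S. (\<lambda>t. u (x + t *\<^sub>R b)) differentiable (at 0))"

definition C2_on :: "'a::euclidean_space set \<Rightarrow> ('a \<Rightarrow> real) \<Rightarrow> bool" where
  "C2_on S u \<longleftrightarrow>
     continuous_on S u \<and> has_partial_derivs_on S u \<and>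
     (\<forall>b\<in>Basis. continuous_on S (partial_deriv b u) \<and> has_partial_derivs_on S (partial_deriv b u) \<and>
       (\<forall>c\<in>Basis. continuous_on S (partial_deriv c (partial_deriv b u))))"

definition laplacian :: "('a::euclidean_space \<Rightarrow> real) \<Rightarrow> 'a \<Rightarrow> real" where
  "laplacian u x = (\<Sum>b\<in>Basis. partial_deriv b (partial_deriv b u) x)"

definition harmonic_on :: "'a::euclidean_space set \<Rightarrow> ('a \<Rightarrow> real) \<Rightarrow> bool" where
  "harmonic_on S u \<longleftrightarrow> open S \<and> C2_on S u \<and> (\<forall>x\<in>S. laplacian u x = 0)"

abbreviation partial_last :: "((real ^ 'n) \<times> real \<Rightarrow> real) \<Rightarrow> (real ^ 'n) \<times> real \<Rightarrow> real" where
  "partial_last \<equiv> partial_deriv (0, 1)"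

definition eta :: "(real ^ 'n) \<times> real" where
  "eta = (0, -1)"

text \<open>In the next two definitions \<open>d\<close> is meant to be \<open>CARD('n) + 1\<close>.\<close>

definition Fstar :: "nat \<Rightarrow> nat \<Rightarrow> real \<Rightarrow> real ^ 'n \<Rightarrow> real" where
  "Fstar d m \<epsilon> x =
     2 ^ (2 * m - 2) * pochhammer (real d / 2) (m - 1) / fact m *
     (\<epsilon> ^ (2 * m - 1) / norm ((x, 0) - \<epsilon> *\<^sub>R eta) ^ (2 * m + d - 2))"

text \<open>The last branch is the case \<open>d = 2\<close>.\<close>

definition Hstar :: "nat \<Rightarrow> nat \<Rightarrow> real \<Rightarrow> (real ^ 'n) \<times> real \<Rightarrow> real" where
  "Hstar d m \<epsilon> x =
     (if d \<ge> 3 then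
        \<Sum>l = 1..m. (-1) ^ l * 2 ^ (l - 1) * fact (2 * m - l - 1) /
            (fact (l - 1) * fact m * fact (m - l) * (real d - 2)) * \<epsilon> ^ (l - 1) *
            (partial_last ^^ l) (\<lambda>y. 1 / norm (y - \<epsilon> *\<^sub>R eta) ^ (d - 2)) x
      else
        \<Sum>l = 1..m. (-1) ^ l * 2 ^ (l - 1) * fact (2 * m - l - 1) /
            (fact (l - 1) * fact m * fact (m - l)) * \<epsilon> ^ (l - 1) *
            (partial_last ^^ l) (\<lambda>y. ln (1 / norm (y - \<epsilon> *\<^sub>R eta))) x)"

end

theory Submission
  imports Defs
begin

text \<open>
  Put \<open>p = \<epsilon> *\<^sub>R eta\<close>. The fundamental solution \<open>u\<close> with pole \<open>p\<close>, that is
  \<open>1 / norm (x - p) ^ (d - 2)\<close> or \<open>ln (1 / norm (x - p))\<close>, is harmonic off \<open>p\<close>. Partial derivatives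
  commute with the Laplacian, so all \<open>\<partial>\<^sub>d\<^sup>l u\<close> and their linear combinations are
  harmonic off \<open>p\<close> as well. To avoid a general theory of smooth functions, this is done in
  a class of functions that contains \<open>u\<close>, consists of functions smooth off \<open>p\<close>, is closed under
  partial derivatives, and on which mixed partial derivatives commute
  (\<open>elementary_partial_deriv\<close>, \<open>partial_deriv_commute\<close>).

  The boundary values come from an identity on the vertical line through \<open>x\<close>, with
  \<open>t = x\<^sub>d + \<epsilon>\<close> as the coordinate. Up to a constant factor, \<open>\<partial>\<^sub>d u\<close> is \<open>g(t) = t / r(t) ^ d\<close>
  there, where \<open>r(t)\<^sup>2 = \<bar>x\<bar>\<^sup>2 + t\<^sup>2\<close>. At \<open>x\<^sub>d = 0\<close> the power \<open>\<epsilon>\<^sup>l\<^sup>-\<^sup>1\<close> is \<open>t\<^sup>l\<^sup>-\<^sup>1\<close>, and with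
  \<open>n = m - 1\<close> the sum defining \<open>Hstar\<close> becomes, up to the factor \<open>1 / m!\<close>,
  \<open>L\<^sub>n g = (\<Sum>k\<le>n. (-2)\<^sup>k (2n-k)! / (k! (n-k)!) t\<^sup>k g\<^sup>(\<^sup>k\<^sup>))\<close>. This Euler operator satisfies
  \<open>L\<^sub>n\<^sub>+\<^sub>1 = -2 (t d/dt - (2n+1)) L\<^sub>n\<close>, by a recurrence for its coefficients. Applying the factor to
  \<open>t\<^sup>2\<^sup>n\<^sup>+\<^sup>1 / r\<^sup>2\<^sup>n\<^sup>+\<^sup>d\<close> gives \<open>2 (2n+d) t\<^sup>2\<^sup>n\<^sup>+\<^sup>3 / r\<^sup>2\<^sup>n\<^sup>+\<^sup>2\<^sup>+\<^sup>d\<close>, whence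
  \<open>L\<^sub>n g = 4\<^sup>n (d/2)\<^sub>n t\<^sup>2\<^sup>n\<^sup>+\<^sup>1 / r\<^sup>2\<^sup>n\<^sup>+\<^sup>d\<close> by induction (\<open>op_coeff_derivative_identity\<close>).

  The two estimates rest on \<open>(\<bar>x\<bar> + \<epsilon>) / 2 \<le> sqrt (\<bar>x\<bar>\<^sup>2 + \<epsilon>\<^sup>2) \<le> \<bar>x\<bar> + \<epsilon>\<close>: the left half gives the
  pointwise bound and integrability, and the right half bounds \<open>Fstar\<close> below on the ball of
  radius \<open>\<epsilon>\<close> by a multiple of \<open>\<epsilon>\<^sup>1\<^sup>-\<^sup>d\<close>, which is balanced by the volume of that ball.
\<close>

section \<open>Partial derivatives of elementary functions with one singular point\<close>

text \<open>
  The functions generated by constants, linear functionals of \<open>x - p\<close>, \<open>1 / norm (x - p)\<close> and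
  \<open>ln (1 / norm (x - p))\<close> under sums and products. Only the values off \<open>p\<close> matter: by the last
  rule, the value at \<open>p\<close> may be changed arbitrarily. This makes the class closed under
  \<open>partial_deriv\<close>, whose value at \<open>p\<close> is meaningless.
\<close>

inductive elementary :: "'a::euclidean_space \<Rightarrow> ('a \<Rightarrow> real) \<Rightarrow> bool" for p :: 'a where
  elementary_const: "elementary p (\<lambda>x. c)"
| elementary_coord: "elementary p (\<lambda>x. (x - p) \<bullet> b)"
| elementary_inv_norm: "elementary p (\<lambda>x. 1 / norm (x - p))"
| elementary_ln: "elementary p (\<lambda>x. ln (1 / norm (x - p)))"
| elementary_add: "elementary p f \<Longrightarrow> elementary p g \<Longrightarrow> elementary p (\<lambda>x. f x + g x)"
| elementary_mult: "elementary p f \<Longrightarrow> elementary p g \<Longrightarrow> elementary p (\<lambda>x. f x * g x)"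
| elementary_cong: "elementary p f \<Longrightarrow> (\<And>x. x \<noteq> p \<Longrightarrow> g x = f x) \<Longrightarrow> elementary p g"

lemma elementary_power: "elementary p f \<Longrightarrow> elementary p (\<lambda>x. f x ^ k)"
  by (induction k) (auto intro: elementary_const elementary_mult)

lemma elementary_inv_norm_power: "elementary p (\<lambda>x. 1 / norm (x - p) ^ k)"
  using elementary_power[OF elementary_inv_norm, of p k] by (simp add: power_divide)

lemma elementary_continuous_on:
  assumes "elementary p f" shows "continuous_on (UNIV - {p}) f"
  using assms
proof induction
  case (elementary_cong f g)
  have "continuous_on (UNIV - {p}) g \<longleftrightarrow> continuous_on (UNIV - {p}) f"
    by (rule continuous_on_cong) (use elementary_cong in auto)
  then show ?case using elementary_cong by simp
qed (auto intro!: continuous_intros)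

lemma DERIV_inverse_power_fun:
  fixes f :: "real \<Rightarrow> real"
  assumes "(f has_real_derivative D) (at t)" "f t \<noteq> 0"
  shows "((\<lambda>t. 1 / f t ^ k) has_real_derivative - real k * D / f t ^ (k + 1)) (at t)"
proof (cases k)
  case (Suc j)
  have "((\<lambda>t. f t ^ Suc j) has_real_derivative real (Suc j) * (D * f t ^ j)) (at t)"
    using DERIV_power[OF assms(1), of "Suc j"] by simp
  from DERIV_divide[OF DERIV_const[of 1] this] assms(2) show ?thesis
    unfolding Suc by (rule_tac DERIV_cong) (auto simp: divide_simps algebra_simps)
qed simp

lemma DERIV_norm_line:
  fixes x p b :: "'a::euclidean_space"
  assumes "x \<noteq> p"
  shows "((\<lambda>t. norm (x + t *\<^sub>R b - p)) has_real_derivative ((x - p) \<bullet> b) / norm (x - p)) (at 0)"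
proof -
  have pos: "(x - p) \<bullet> (x - p) > 0" using assms by simp
  have eq: "(x + t *\<^sub>R b - p) \<bullet> (x + t *\<^sub>R b - p)
      = (x - p) \<bullet> (x - p) + 2 * t * ((x - p) \<bullet> b) + t\<^sup>2 * (b \<bullet> b)" for t
    by (simp add: algebra_simps inner_commute power2_eq_square)
  have "((\<lambda>t. sqrt (q + 2 * t * \<beta> + t\<^sup>2 * \<gamma>)) has_real_derivative \<beta> / sqrt q) (at 0)"
    if "q > 0" for q \<beta> \<gamma> :: real
    using that by (auto intro!: derivative_eq_intros simp: field_simps)
  from this[OF pos, of "(x - p) \<bullet> b" "b \<bullet> b"] show ?thesis
    unfolding norm_eq_sqrt_inner eq .
qed

lemma DERIV_inv_norm_power_line:
  fixes x p b :: "'a::euclidean_space"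
  assumes "x \<noteq> p"
  shows "((\<lambda>t. 1 / norm (x + t *\<^sub>R b - p) ^ k) has_real_derivative
           - real k * ((x - p) \<bullet> b) / norm (x - p) ^ (k + 2)) (at 0)"
  using DERIV_inverse_power_fun[OF DERIV_norm_line[OF assms, of b], of k] assms
  by (simp add: mult.assoc)

lemma DERIV_ln_norm_line:
  fixes x p b :: "'a::euclidean_space"
  assumes "x \<noteq> p"
  shows "((\<lambda>t. ln (1 / norm (x + t *\<^sub>R b - p))) has_real_derivative
           - ((x - p) \<bullet> b) / norm (x - p) ^ 2) (at 0)"
proof -
  have "norm (x - p) > 0" using assms by simp
  then show ?thesis
    by (auto intro!: derivative_eq_intros DERIV_norm_line assms simp: field_simps power2_eq_square)
qed

lemma DERIV_coord_line:
  fixes x p b c :: "'a::euclidean_space"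
  shows "((\<lambda>t. (x + t *\<^sub>R b - p) \<bullet> c) has_real_derivative b \<bullet> c) (at 0)"
proof -
  have "(x + t *\<^sub>R b - p) \<bullet> c = (x - p) \<bullet> c + t * (b \<bullet> c)" for t
    by (simp add: algebra_simps)
  then show ?thesis by (auto intro!: derivative_eq_intros)
qed

lemma eventually_line_avoids:
  fixes x p b :: "'a::euclidean_space"
  assumes "x \<noteq> p" shows "eventually (\<lambda>t::real. x + t *\<^sub>R b \<noteq> p) (nhds 0)"
proof -
  have "continuous (at 0) (\<lambda>t::real. x + t *\<^sub>R b)" by (intro continuous_intros)
  then have "((\<lambda>t::real. x + t *\<^sub>R b) \<longlongrightarrow> x + 0 *\<^sub>R b) (nhds 0)"
    using tendsto_at_iff_tendsto_nhds[of "\<lambda>t::real. x + t *\<^sub>R b" 0] by (simp add: continuous_at)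
  then show ?thesis by (rule tendsto_imp_eventually_ne) (use assms in simp)
qed

lemma DERIV_line_cong:
  fixes x p b :: "'a::euclidean_space"
  assumes "x \<noteq> p" and "\<And>y. y \<noteq> p \<Longrightarrow> g y = f y"
  shows "((\<lambda>t. g (x + t *\<^sub>R b)) has_real_derivative D) (at 0) \<longleftrightarrow>
         ((\<lambda>t. f (x + t *\<^sub>R b)) has_real_derivative D) (at 0)"
  by (rule DERIV_cong_ev)
     (use assms in \<open>auto intro: eventually_mono[OF eventually_line_avoids]\<close>)

lemma partial_deriv_cong:
  fixes x p b :: "'a::euclidean_space"
  assumes "x \<noteq> p" and "\<And>y. y \<noteq> p \<Longrightarrow> g y = f y"
  shows "partial_deriv b g x = partial_deriv b f x"
  using DERIV_line_cong[where b = b and f = f and g = g, OF assms]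
  by (simp add: partial_deriv_def deriv_def)

lemma partial_deriv_eqI:
  "((\<lambda>t. f (x + t *\<^sub>R b)) has_real_derivative D) (at 0) \<Longrightarrow> partial_deriv b f x = D"
  by (simp add: partial_deriv_def DERIV_imp_deriv)

text \<open>
  The induction needs the derivative and its membership in the class at once. The direction \<open>b\<close> is
  arbitrary, not only a basis vector.
\<close>
lemma elementary_has_partial:
  assumes "elementary p f"
  shows "\<exists>f'. elementary p f' \<and>
           (\<forall>x. x \<noteq> p \<longrightarrow> ((\<lambda>t. f (x + t *\<^sub>R b)) has_real_derivative f' x) (at 0))"
  using assms
proof induction
  case (elementary_const c)
  show ?case by (rule exI[of _ "\<lambda>x. 0"]) (auto intro: elementary.intros(1-6))
next
  case (elementary_coord c)
  show ?case
    by (rule exI[of _ "\<lambda>x. b \<bullet> c"]) (auto intro: elementary.intros(1-6) DERIV_coord_line)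
next
  case elementary_inv_norm
  have "elementary p (\<lambda>x. (-1) * ((x - p) \<bullet> b) * (1 / norm (x - p) ^ 3))"
    by (intro elementary.intros(1-6) elementary_inv_norm_power)
  then show ?case
    using DERIV_inv_norm_power_line[of _ p b 1]
    by (intro exI[of _ "\<lambda>x. (-1) * ((x - p) \<bullet> b) * (1 / norm (x - p) ^ 3)"])
       (auto simp: numeral_3_eq_3)
next
  case elementary_ln
  have "elementary p (\<lambda>x. (-1) * ((x - p) \<bullet> b) * (1 / norm (x - p) ^ 2))"
    by (intro elementary.intros(1-6) elementary_inv_norm_power)
  then show ?case
    using DERIV_ln_norm_line[of _ p b]
    by (intro exI[of _ "\<lambda>x. (-1) * ((x - p) \<bullet> b) * (1 / norm (x - p) ^ 2)"]) auto
next
  case (elementary_add f g)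
  then obtain f' g' where "elementary p f'" "elementary p g'"
    "\<forall>x. x \<noteq> p \<longrightarrow> ((\<lambda>t. f (x + t *\<^sub>R b)) has_real_derivative f' x) (at 0)"
    "\<forall>x. x \<noteq> p \<longrightarrow> ((\<lambda>t. g (x + t *\<^sub>R b)) has_real_derivative g' x) (at 0)" by blast
  then show ?case
    by (intro exI[of _ "\<lambda>x. f' x + g' x"]) (auto intro: elementary.intros(1-6) DERIV_add)
next
  case (elementary_mult f g)
  then obtain f' g' where "elementary p f'" "elementary p g'"
    "\<forall>x. x \<noteq> p \<longrightarrow> ((\<lambda>t. f (x + t *\<^sub>R b)) has_real_derivative f' x) (at 0)"
    "\<forall>x. x \<noteq> p \<longrightarrow> ((\<lambda>t. g (x + t *\<^sub>R b)) has_real_derivative g' x) (at 0)" by blast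
  with elementary_mult show ?case
    by (intro exI[of _ "\<lambda>x. f' x * g x + g' x * f x"])
       (auto intro!: elementary.intros(5,6) derivative_eq_intros)
next
  case (elementary_cong f g)
  then show ?case using DERIV_line_cong[of _ p g f b] by metis
qed

lemma elementary_DERIV:
  assumes "elementary p f" "x \<noteq> p"
  shows "((\<lambda>t. f (x + t *\<^sub>R b)) has_real_derivative partial_deriv b f x) (at 0)"
  using elementary_has_partial[OF assms(1), of b] assms(2) partial_deriv_eqI by metis

lemma elementary_partial_deriv:
  assumes "elementary p f" shows "elementary p (partial_deriv b f)"
proof -
  obtain f' where "elementary p f'"
    "\<forall>x. x \<noteq> p \<longrightarrow> ((\<lambda>t. f (x + t *\<^sub>R b)) has_real_derivative f' x) (at 0)"
    using elementary_has_partial[OF assms] by blast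
  then show ?thesis
    by (auto intro: elementary_cong[of p f'] partial_deriv_eqI)
qed

lemma elementary_C2_on:
  assumes "elementary p f" shows "C2_on (UNIV - {p}) f"
proof -
  have "has_partial_derivs_on (UNIV - {p}) g" if "elementary p g" for g
    unfolding has_partial_derivs_on_def
    using elementary_DERIV[OF that] real_differentiable_def by blast
  then show ?thesis
    unfolding C2_on_def
    by (auto intro!: elementary_continuous_on elementary_partial_deriv assms)
qed

lemma partial_deriv_add:
  assumes "elementary p f" "elementary p g" "x \<noteq> p"
  shows "partial_deriv b (\<lambda>x. f x + g x) x = partial_deriv b f x + partial_deriv b g x"
  by (intro partial_deriv_eqI DERIV_add elementary_DERIV[of p] assms)

lemma partial_deriv_mult:
  assumes "elementary p f" "elementary p g" "x \<noteq> p"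
  shows "partial_deriv b (\<lambda>x. f x * g x) x = partial_deriv b f x * g x + f x * partial_deriv b g x"
  using DERIV_mult[OF elementary_DERIV[OF assms(1,3), of b] elementary_DERIV[OF assms(2,3), of b]]
  by (intro partial_deriv_eqI) (simp add: mult.commute)

lemma partial_deriv_const: "partial_deriv b (\<lambda>x. c) x = 0"
  by (rule partial_deriv_eqI) simp

lemma partial_deriv_coord: "partial_deriv b (\<lambda>x. (x - p) \<bullet> c) x = b \<bullet> c"
  by (intro partial_deriv_eqI DERIV_coord_line)

lemma partial_deriv_inv_norm_power:
  "x \<noteq> p \<Longrightarrow> partial_deriv b (\<lambda>x. 1 / norm (x - p) ^ k) x
     = - real k * ((x - p) \<bullet> b) / norm (x - p) ^ (k + 2)"
  by (intro partial_deriv_eqI DERIV_inv_norm_power_line)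

lemma partial_deriv_ln_norm:
  "x \<noteq> p \<Longrightarrow> partial_deriv b (\<lambda>x. ln (1 / norm (x - p))) x = - ((x - p) \<bullet> b) / norm (x - p) ^ 2"
  by (intro partial_deriv_eqI DERIV_ln_norm_line)

lemma partial_deriv_coord_inv_norm_power:
  assumes "x \<noteq> p"
  shows "partial_deriv b (\<lambda>x. a * ((x - p) \<bullet> c) / norm (x - p) ^ k) x
     = a * (b \<bullet> c) / norm (x - p) ^ k
       - a * real k * ((x - p) \<bullet> b) * ((x - p) \<bullet> c) / norm (x - p) ^ (k + 2)"
proof -
  have "((\<lambda>t. a * ((x + t *\<^sub>R b - p) \<bullet> c) * (1 / norm (x + t *\<^sub>R b - p) ^ k)) has_real_derivative
      (a * (b \<bullet> c)) * (1 / norm (x + 0 *\<^sub>R b - p) ^ k)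
      + (- real k * ((x - p) \<bullet> b) / norm (x - p) ^ (k + 2)) * (a * ((x + 0 *\<^sub>R b - p) \<bullet> c))) (at 0)"
    by (intro DERIV_mult DERIV_cmult DERIV_coord_line DERIV_inv_norm_power_line assms)
  from partial_deriv_eqI[where f = "\<lambda>x. a * ((x - p) \<bullet> c) * (1 / norm (x - p) ^ k)", OF this]
  show ?thesis by (simp add: mult_ac)
qed

lemma partial_deriv2_inv_norm_power:
  assumes "x \<noteq> p"
  shows "partial_deriv b (partial_deriv c (\<lambda>x. 1 / norm (x - p) ^ k)) x
     = - real k * (b \<bullet> c) / norm (x - p) ^ (k + 2)
       + real k * real (k + 2) * ((x - p) \<bullet> b) * ((x - p) \<bullet> c) / norm (x - p) ^ (k + 4)"
proof -
  have "partial_deriv b (partial_deriv c (\<lambda>x. 1 / norm (x - p) ^ k)) x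
      = partial_deriv b (\<lambda>x. (- real k) * ((x - p) \<bullet> c) / norm (x - p) ^ (k + 2)) x"
    by (intro partial_deriv_cong[OF assms] partial_deriv_inv_norm_power)
  also have "\<dots> = - real k * (b \<bullet> c) / norm (x - p) ^ (k + 2)
       + real k * real (k + 2) * ((x - p) \<bullet> b) * ((x - p) \<bullet> c) / norm (x - p) ^ (k + 4)"
    unfolding partial_deriv_coord_inv_norm_power[OF assms] by (simp add: eval_nat_numeral)
  finally show ?thesis .
qed

lemma partial_deriv2_ln_norm:
  assumes "x \<noteq> p"
  shows "partial_deriv b (partial_deriv c (\<lambda>x. ln (1 / norm (x - p)))) x
     = - (b \<bullet> c) / norm (x - p) ^ 2
       + 2 * ((x - p) \<bullet> b) * ((x - p) \<bullet> c) / norm (x - p) ^ 4"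
proof -
  have "partial_deriv b (partial_deriv c (\<lambda>x. ln (1 / norm (x - p)))) x
      = partial_deriv b (\<lambda>x. (- 1) * ((x - p) \<bullet> c) / norm (x - p) ^ 2) x"
    by (intro partial_deriv_cong[OF assms]) (simp add: partial_deriv_ln_norm)
  also have "\<dots> = - (b \<bullet> c) / norm (x - p) ^ 2
       + 2 * ((x - p) \<bullet> b) * ((x - p) \<bullet> c) / norm (x - p) ^ 4"
    unfolding partial_deriv_coord_inv_norm_power[OF assms] by simp
  finally show ?thesis .
qed

text \<open>
  Symmetry of second derivatives, by induction on the generation of \<open>f\<close>: the second derivatives
  of the generators are computed, and the product rule preserves symmetry.
\<close>
lemma partial_deriv_commute:
  assumes "elementary p f" "x \<noteq> p"
  shows "partial_deriv b (partial_deriv c f) x = partial_deriv c (partial_deriv b f) x"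
  using assms
proof (induction arbitrary: x)
  case (elementary_const a)
  have "partial_deriv c (\<lambda>x. a) = (\<lambda>x. 0)" for c :: 'a by (simp add: partial_deriv_const fun_eq_iff)
  then show ?case by (simp add: partial_deriv_const)
next
  case (elementary_coord a)
  have "partial_deriv c (\<lambda>x. (x - p) \<bullet> a) = (\<lambda>x. c \<bullet> a)" for c
    by (simp add: partial_deriv_coord fun_eq_iff)
  then show ?case by (simp add: partial_deriv_const)
next
  case elementary_inv_norm
  show ?case
    using partial_deriv2_inv_norm_power[OF elementary_inv_norm, of b c 1]
      partial_deriv2_inv_norm_power[OF elementary_inv_norm, of c b 1]
    by (simp add: inner_commute mult_ac)
next
  case elementary_ln
  then show ?case by (simp add: partial_deriv2_ln_norm inner_commute mult_ac)
next
  case (elementary_add f g)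
  have "partial_deriv b (partial_deriv c (\<lambda>x. f x + g x)) x
      = partial_deriv b (partial_deriv c f) x + partial_deriv b (partial_deriv c g) x" for b c
  proof -
    have "partial_deriv b (partial_deriv c (\<lambda>x. f x + g x)) x
      = partial_deriv b (\<lambda>x. partial_deriv c f x + partial_deriv c g x) x"
      by (intro partial_deriv_cong[OF elementary_add.prems] partial_deriv_add[of p] elementary_add)
    then show ?thesis
      using elementary_add.hyps elementary_add.prems
      by (simp add: partial_deriv_add[of p] elementary_partial_deriv)
  qed
  then show ?case using elementary_add.IH elementary_add.prems by simp
next
  case (elementary_mult f g)
  have "partial_deriv b (partial_deriv c (\<lambda>x. f x * g x)) x
      = partial_deriv b (partial_deriv c f) x * g x + partial_deriv c f x * partial_deriv b g x
        + (partial_deriv b f x * partial_deriv c g x + f x * partial_deriv b (partial_deriv c g) x)" for b c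
  proof -
    have "partial_deriv b (partial_deriv c (\<lambda>x. f x * g x)) x
      = partial_deriv b (\<lambda>x. partial_deriv c f x * g x + f x * partial_deriv c g x) x"
      by (intro partial_deriv_cong[OF elementary_mult.prems] partial_deriv_mult[of p] elementary_mult)
    then show ?thesis
      using elementary_mult.hyps elementary_mult.prems
      by (simp add: partial_deriv_add[of p] partial_deriv_mult[of p]
          elementary_partial_deriv elementary.elementary_mult)
  qed
  then show ?case using elementary_mult.IH elementary_mult.prems by simp
next
  case (elementary_cong f g)
  have "partial_deriv b (partial_deriv c g) x = partial_deriv b (partial_deriv c f) x" for b c
    by (intro partial_deriv_cong[OF elementary_cong.prems] partial_deriv_cong[of _ p]
        elementary_cong.hyps(2))
  then show ?case using elementary_cong.IH elementary_cong.prems by simp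
qed

section \<open>Harmonic functions with one singular point\<close>

lemma laplacian_add:
  assumes "elementary p f" "elementary p g" "x \<noteq> p"
  shows "laplacian (\<lambda>x. f x + g x) x = laplacian f x + laplacian g x"
proof -
  have "partial_deriv b (partial_deriv b (\<lambda>x. f x + g x)) x
      = partial_deriv b (partial_deriv b f) x + partial_deriv b (partial_deriv b g) x" for b
  proof -
    have "partial_deriv b (partial_deriv b (\<lambda>x. f x + g x)) x
      = partial_deriv b (\<lambda>x. partial_deriv b f x + partial_deriv b g x) x"
      by (intro partial_deriv_cong[OF assms(3)] partial_deriv_add[of p] assms)
    then show ?thesis
      using assms by (simp add: partial_deriv_add[of p] elementary_partial_deriv)
  qed
  then show ?thesis by (simp add: laplacian_def sum.distrib)
qed

lemma laplacian_cmult: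
  assumes "elementary p f" "x \<noteq> p"
  shows "laplacian (\<lambda>x. a * f x) x = a * laplacian f x"
proof -
  have 1: "partial_deriv b (\<lambda>x. a * h x) y = a * partial_deriv b h y"
    if "elementary p h" "y \<noteq> p" for b h y
    using partial_deriv_mult[OF elementary_const that] by (simp add: partial_deriv_const)
  have "partial_deriv b (partial_deriv b (\<lambda>x. a * f x)) x
      = a * partial_deriv b (partial_deriv b f) x" for b
    using 1[OF assms(1)] 1[OF elementary_partial_deriv[OF assms(1)] assms(2)]
      partial_deriv_cong[OF assms(2), of "partial_deriv b (\<lambda>x. a * f x)" "\<lambda>x. a * partial_deriv b f x"]
    by simp
  then show ?thesis by (simp add: laplacian_def sum_distrib_left)
qed

lemma elementary_sum:
  assumes "\<And>i. i \<in> I \<Longrightarrow> elementary p (f i)"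
  shows "elementary p (\<lambda>x. \<Sum>i\<in>I. f i x)"
  using assms
  by (induction I rule: infinite_finite_induct) (auto intro: elementary_const elementary_add)

lemma laplacian_partial_deriv:
  assumes "elementary p f" "x \<noteq> p"
  shows "laplacian (partial_deriv c f) x = partial_deriv c (laplacian f) x"
proof -
  have "((\<lambda>t. \<Sum>b\<in>Basis. partial_deriv b (partial_deriv b f) (x + t *\<^sub>R c)) has_real_derivative
     (\<Sum>b\<in>Basis. partial_deriv c (partial_deriv b (partial_deriv b f)) x)) (at 0)"
    by (intro DERIV_sum elementary_DERIV[of p] elementary_partial_deriv assms)
  then have "partial_deriv c (laplacian f) x
      = (\<Sum>b\<in>Basis. partial_deriv c (partial_deriv b (partial_deriv b f)) x)"
    by (intro partial_deriv_eqI) (simp add: laplacian_def)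
  also have "\<dots> = (\<Sum>b\<in>Basis. partial_deriv b (partial_deriv c (partial_deriv b f)) x)"
    by (intro sum.cong refl partial_deriv_commute[of p] elementary_partial_deriv assms)
  also have "\<dots> = (\<Sum>b\<in>Basis. partial_deriv b (partial_deriv b (partial_deriv c f)) x)"
    by (intro sum.cong refl partial_deriv_cong[OF assms(2)] partial_deriv_commute[OF assms(1)])
  finally show ?thesis by (simp add: laplacian_def)
qed

text \<open>Elementary functions that are harmonic off their singular point.\<close>
definition elementary_harmonic :: "'a::euclidean_space \<Rightarrow> ('a \<Rightarrow> real) \<Rightarrow> bool" where
  "elementary_harmonic p f \<longleftrightarrow> elementary p f \<and> (\<forall>x. x \<noteq> p \<longrightarrow> laplacian f x = 0)"

lemma elementary_harmonic_imp_harmonic_on: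
  "elementary_harmonic p f \<Longrightarrow> harmonic_on (UNIV - {p}) f"
  by (auto simp: elementary_harmonic_def harmonic_on_def intro: elementary_C2_on)

lemma elementary_harmonic_partial_deriv:
  assumes "elementary_harmonic p f" shows "elementary_harmonic p (partial_deriv c f)"
proof -
  have "laplacian (partial_deriv c f) x = 0" if "x \<noteq> p" for x
  proof -
    have "laplacian (partial_deriv c f) x = partial_deriv c (laplacian f) x"
      using assms that by (intro laplacian_partial_deriv) (auto simp: elementary_harmonic_def)
    also have "\<dots> = partial_deriv c (\<lambda>x. 0) x"
      using assms by (intro partial_deriv_cong[OF that]) (auto simp: elementary_harmonic_def)
    finally show ?thesis by (simp add: partial_deriv_const)
  qed
  then show ?thesis
    using assms by (auto simp: elementary_harmonic_def intro: elementary_partial_deriv)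
qed

lemma elementary_harmonic_funpow_partial_deriv:
  "elementary_harmonic p f \<Longrightarrow> elementary_harmonic p ((partial_deriv c ^^ l) f)"
  by (induction l) (auto intro: elementary_harmonic_partial_deriv)

lemma elementary_harmonic_combination:
  assumes "\<And>i. i \<in> I \<Longrightarrow> elementary_harmonic p (f i)"
  shows "elementary_harmonic p (\<lambda>x. \<Sum>i\<in>I. a i * f i x)"
  using assms
proof (induction I rule: infinite_finite_induct)
  case (insert i I)
  have 1: "elementary p (f i)" "elementary p (\<lambda>x. a i * f i x)" "elementary p (\<lambda>x. \<Sum>i\<in>I. a i * f i x)"
    using insert by (auto simp: elementary_harmonic_def intro: elementary_const elementary_mult)
  show ?case
    using insert 1
    by (auto simp: elementary_harmonic_def laplacian_add[of p] laplacian_cmult[of p]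
        intro: elementary_add)
qed (auto simp: elementary_harmonic_def laplacian_def partial_deriv_def elementary_const)

lemma elementary_harmonic_inv_norm_power:
  fixes p :: "'a::euclidean_space"
  assumes "k + 2 = DIM('a)"
  shows "elementary_harmonic p (\<lambda>x. 1 / norm (x - p) ^ k)"
proof -
  have "laplacian (\<lambda>x. 1 / norm (x - p) ^ k) x = 0" if "x \<noteq> p" for x :: 'a
  proof -
    have n: "norm (x - p) \<noteq> 0" using that by simp
    have sq: "(\<Sum>b\<in>Basis. ((x - p) \<bullet> b) * ((x - p) \<bullet> b)) = norm (x - p) ^ 2"
      unfolding power2_norm_eq_inner by (rule euclidean_inner[symmetric])
    have "laplacian (\<lambda>x. 1 / norm (x - p) ^ k) x
        = (\<Sum>b\<in>(Basis :: 'a set). - real k / norm (x - p) ^ (k + 2)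
            + real k * real (k + 2) / norm (x - p) ^ (k + 4) * (((x - p) \<bullet> b) * ((x - p) \<bullet> b)))"
      unfolding laplacian_def
      by (intro sum.cong refl) (simp add: partial_deriv2_inv_norm_power[OF that])
    also have "\<dots> = - real k * real DIM('a) / norm (x - p) ^ (k + 2)
        + real k * real (k + 2) / norm (x - p) ^ (k + 4) * norm (x - p) ^ 2"
      unfolding sum.distrib sum_distrib_left[symmetric] sq by (simp add: sum_negf)
    also have "\<dots> = 0"
      using n assms[symmetric] by (simp add: field_simps power_add eval_nat_numeral)
    finally show ?thesis .
  qed
  then show ?thesis by (simp add: elementary_harmonic_def elementary_inv_norm_power)
qed

lemma elementary_harmonic_ln_norm:
  fixes p :: "'a::euclidean_space"
  assumes "DIM('a) = 2"
  shows "elementary_harmonic p (\<lambda>x. ln (1 / norm (x - p)))"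
proof -
  have "laplacian (\<lambda>x. ln (1 / norm (x - p))) x = 0" if "x \<noteq> p" for x :: 'a
  proof -
    have n: "norm (x - p) \<noteq> 0" using that by simp
    have sq: "(\<Sum>b\<in>Basis. ((x - p) \<bullet> b) * ((x - p) \<bullet> b)) = norm (x - p) ^ 2"
      unfolding power2_norm_eq_inner by (rule euclidean_inner[symmetric])
    have "laplacian (\<lambda>x. ln (1 / norm (x - p))) x
        = (\<Sum>b\<in>(Basis :: 'a set). - 1 / norm (x - p) ^ 2
            + 2 / norm (x - p) ^ 4 * (((x - p) \<bullet> b) * ((x - p) \<bullet> b)))"
      unfolding laplacian_def
      by (intro sum.cong refl) (simp add: partial_deriv2_ln_norm[OF that])
    also have "\<dots> = - real DIM('a) / norm (x - p) ^ 2 + 2 / norm (x - p) ^ 4 * norm (x - p) ^ 2"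
      unfolding sum.distrib sum_distrib_left[symmetric] sq by simp
    also have "\<dots> = 0"
      using n assms by (simp add: field_simps eval_nat_numeral)
    finally show ?thesis .
  qed
  then show ?thesis by (simp add: elementary_harmonic_def elementary_ln)
qed

section \<open>A differential identity on a line\<close>

text \<open>
  The coefficients of the operator \<open>L\<^sub>n = (\<Sum>k\<le>n. op_coeff n k * t ^ k * (d/dt) ^ k)\<close>. They are
  set to \<open>0\<close> for \<open>k > n\<close>, so that the recurrence below holds for all \<open>k\<close>.
\<close>
definition op_coeff :: "nat \<Rightarrow> nat \<Rightarrow> real" where
  "op_coeff n k = (if k \<le> n then (-2) ^ k * fact (2 * n - k) / (fact k * fact (n - k)) else 0)"

lemma op_coeff_Suc_0: "op_coeff (Suc n) 0 = 2 * (2 * real n + 1) * op_coeff n 0"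
proof -
  have "2 * Suc n = Suc (Suc (2 * n))" by simp
  then have 1: "(fact (2 * Suc n) :: real) = 2 * (real n + 1) * ((2 * real n + 1) * fact (2 * n))"
    by (simp only: fact_Suc) (simp add: algebra_simps)
  have 2: "(fact (Suc n) :: real) = (real n + 1) * fact n" by simp
  have 3: "2 * a * (b * f) / (a * g) = 2 * b * (f / g)" if "a \<noteq> 0" for a b f g :: real
    using that by simp
  have "op_coeff (Suc n) 0 = fact (2 * Suc n) / fact (Suc n)" by (simp add: op_coeff_def)
  also have "\<dots> = 2 * (2 * real n + 1) * (fact (2 * n) / fact n)"
    unfolding 1 2 by (rule 3) simp
  finally show ?thesis by (simp add: op_coeff_def)
qed

lemma op_coeff_Suc_Suc:
  "op_coeff (Suc n) (Suc k) = -2 * (op_coeff n k + (real k - 2 * real n) * op_coeff n (Suc k))"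
proof -
  consider "k > n" | "k = n" | "k < n" by linarith
  then show ?thesis
  proof cases
    case 2
    have "2 * Suc k - Suc k = Suc k" "2 * k - k = k" by auto
    then have "op_coeff (Suc k) (Suc k) = (-2) ^ Suc k" "op_coeff k k = (-2) ^ k"
      by (auto simp: op_coeff_def simp del: fact_Suc)
    then show ?thesis using 2 by (simp add: op_coeff_def)
  next
    case 3
    define j where "j = n - k - 1"
    then have n: "n = k + j + 1" using 3 by simp
    have *: "2 * Suc n - Suc k = Suc (Suc (k + 2 * j + 1))" "2 * n - k = Suc (k + 2 * j + 1)"
      "2 * n - Suc k = k + 2 * j + 1" "Suc n - Suc k = Suc j" "n - k = Suc j" "n - Suc k = j"
      using n by auto
    define A :: real where "A = (-2) ^ k * fact (k + 2 * j + 1) / (fact k * fact j)"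
    have 1: "op_coeff n k = A * (real k + 2 * real j + 2) / (real j + 1)"
      using 3 unfolding op_coeff_def * A_def by (simp add: add_ac mult_ac)
    have 2: "op_coeff n (Suc k) = -2 * A / (real k + 1)"
      using 3 unfolding op_coeff_def * A_def by (simp add: add_ac mult_ac)
    have 3: "op_coeff (Suc n) (Suc k)
        = -2 * A * ((real k + 2 * real j + 3) * (real k + 2 * real j + 2)) / ((real k + 1) * (real j + 1))"
      using 3 unfolding op_coeff_def * A_def by (simp add: add_ac mult_ac)
    have 4: "real n = real k + real j + 1" using n by simp
    have "(a + 2 * b + 3) * (a + 2 * b + 2) / ((a + 1) * (b + 1))
        = (a + 2 * b + 2) / (b + 1) + (a - 2 * (a + b + 1)) * (-2 / (a + 1))"
      if "a \<ge> 0" "b \<ge> 0" for a b :: real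
      using that by (simp add: divide_simps) (simp add: algebra_simps)
    note * = this[of "real k" "real j", OF of_nat_0_le_iff of_nat_0_le_iff]
    have **: "- 2 * A * (P / Q + c * (- 2 / R)) = - 2 * (A * P / Q + c * (- 2 * A / R))" for P Q R c
      by (simp add: algebra_simps)
    show ?thesis
      unfolding 1 2 3 4 times_divide_eq_right[symmetric, of "- 2 * A"] * by (rule **)
  qed (simp add: op_coeff_def)
qed

text \<open>
  The recurrence \<open>L\<^sub>n\<^sub>+\<^sub>1 = -2 (t d/dt - (2n+1)) L\<^sub>n\<close>, where \<open>y k\<close> stands for \<open>t ^ k\<close> times the
  \<open>k\<close>-th derivative, so that \<open>t d/dt\<close> sends \<open>y k\<close> to \<open>y (Suc k) + k * y k\<close>.
\<close>
lemma op_coeff_sum_Suc: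
  fixes y :: "nat \<Rightarrow> real"
  shows "(\<Sum>k\<le>Suc n. op_coeff (Suc n) k * y k)
     = -2 * (\<Sum>k\<le>n. op_coeff n k * (y (Suc k) + (real k - 1 - 2 * real n) * y k))"
proof -
  have "(\<Sum>k\<le>n. op_coeff n k * ((real k - 1 - 2 * real n) * y k))
      = (\<Sum>k\<le>Suc n. op_coeff n k * ((real k - 1 - 2 * real n) * y k))"
    by (simp add: op_coeff_def)
  also have "\<dots> = op_coeff n 0 * ((- 1 - 2 * real n) * y 0)
      + (\<Sum>k\<le>n. op_coeff n (Suc k) * ((real k - 2 * real n) * y (Suc k)))"
    unfolding sum.atMost_Suc_shift by simp
  finally have *: "(\<Sum>k\<le>n. op_coeff n k * ((real k - 1 - 2 * real n) * y k)) = \<dots>" .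
  have "(\<Sum>k\<le>Suc n. op_coeff (Suc n) k * y k)
      = 2 * (2 * real n + 1) * op_coeff n 0 * y 0
        + (\<Sum>k\<le>n. -2 * (op_coeff n k + (real k - 2 * real n) * op_coeff n (Suc k)) * y (Suc k))"
    unfolding sum.atMost_Suc_shift by (simp add: op_coeff_Suc_0 op_coeff_Suc_Suc)
  also have "(\<Sum>k\<le>n. -2 * (op_coeff n k + (real k - 2 * real n) * op_coeff n (Suc k)) * y (Suc k))
      = -2 * ((\<Sum>k\<le>n. op_coeff n k * y (Suc k))
          + (\<Sum>k\<le>n. op_coeff n (Suc k) * ((real k - 2 * real n) * y (Suc k))))"
    unfolding sum.distrib[symmetric] sum_distrib_left by (intro sum.cong refl) (simp add: algebra_simps)
  finally show ?thesis
    unfolding distrib_left sum.distrib * by (simp add: algebra_simps)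
qed

text \<open>
  Here \<open>G k\<close> is the \<open>k\<close>-th derivative of \<open>t / r t ^ d\<close> on the half-line \<open>t > 0\<close>; the restriction
  keeps away from the zero of \<open>r\<close> that occurs when \<open>s = 0\<close>.
\<close>
lemma op_coeff_derivative_identity:
  fixes G :: "nat \<Rightarrow> real \<Rightarrow> real" and s :: real and d :: nat
  defines "r \<equiv> \<lambda>t. sqrt (s\<^sup>2 + t\<^sup>2)"
  assumes dG: "\<And>k t. t > 0 \<Longrightarrow> (G k has_real_derivative G (Suc k) t) (at t)"
    and G0: "\<And>t. t > 0 \<Longrightarrow> G 0 t = t / r t ^ d"
    and "t > 0"
  shows "(\<Sum>k\<le>n. op_coeff n k * (t ^ k * G k t))
    = 4 ^ n * pochhammer (real d / 2) n * t ^ (2 * n + 1) / r t ^ (2 * n + d)"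
  using \<open>t > 0\<close>
proof (induction n arbitrary: t)
  case 0
  then show ?case by (simp add: op_coeff_def G0)
next
  case (Suc n)
  define C where "C = 4 ^ n * pochhammer (real d / 2) n"
  have rpos: "r t > 0" and rsq: "r t ^ 2 = s\<^sup>2 + t\<^sup>2"
    using Suc.prems by (auto simp: r_def add_nonneg_pos)
  have dr: "(r has_real_derivative t / r t) (at t)"
    unfolding r_def using Suc.prems
    by (auto intro!: derivative_eq_intros add_nonneg_pos simp: field_simps not_sum_power2_lt_zero)
  have dT: "((\<lambda>t. \<Sum>k\<le>n. op_coeff n k * (t ^ k * G k t)) has_real_derivative
      (\<Sum>k\<le>n. op_coeff n k * (real k * t ^ (k - 1) * G k t + t ^ k * G (Suc k) t))) (at t)"
    by (auto intro!: derivative_eq_intros dG Suc.prems sum.cong simp: algebra_simps)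
  have dR: "((\<lambda>t. C * t ^ (2 * n + 1) / r t ^ (2 * n + d)) has_real_derivative
      C * real (2 * n + 1) * t ^ (2 * n) / r t ^ (2 * n + d)
      - C * real (2 * n + d) * t ^ (2 * n + 2) / r t ^ (2 * n + d + 2)) (at t)"
  proof -
    have "((\<lambda>t. C * t ^ (2 * n + 1)) has_real_derivative C * (real (2 * n + 1) * t ^ (2 * n))) (at t)"
      using DERIV_cmult[OF DERIV_pow[of "2 * n + 1" t]] by simp
    from DERIV_mult[OF this DERIV_inverse_power_fun[OF dr, of "2 * n + d"]] rpos
    have "((\<lambda>t. C * t ^ (2 * n + 1) / r t ^ (2 * n + d)) has_real_derivative
        C * (real (2 * n + 1) * t ^ (2 * n)) * (1 / r t ^ (2 * n + d))
        + - real (2 * n + d) * (t / r t) / r t ^ (2 * n + d + 1) * (C * t ^ (2 * n + 1))) (at t)"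
      by simp
    then show ?thesis
      by (rule DERIV_cong) (use rpos in \<open>simp add: minus_divide_left[symmetric] divide_simps\<close>,
          simp add: algebra_simps)
  qed
  have "((\<lambda>t. \<Sum>k\<le>n. op_coeff n k * (t ^ k * G k t)) has_real_derivative
      C * real (2 * n + 1) * t ^ (2 * n) / r t ^ (2 * n + d)
      - C * real (2 * n + d) * t ^ (2 * n + 2) / r t ^ (2 * n + d + 2)) (at t)"
    using dR
    by (rule has_field_derivative_transform_within_open[where S = "{0<..}"])
       (use Suc in \<open>auto simp: C_def\<close>)
  \<comment> \<open>Differentiating the induction hypothesis gives the derivative of the sum in closed form.\<close>
  from DERIV_unique[OF dT this]
  have eq: "(\<Sum>k\<le>n. op_coeff n k * (real k * t ^ (k - 1) * G k t + t ^ k * G (Suc k) t))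
    = C * real (2 * n + 1) * t ^ (2 * n) / r t ^ (2 * n + d)
      - C * real (2 * n + d) * t ^ (2 * n + 2) / r t ^ (2 * n + d + 2)" .
  have tk: "t * (real k * t ^ (k - 1)) = real k * t ^ k" for k by (cases k) auto
  have "(\<Sum>k\<le>Suc n. op_coeff (Suc n) k * (t ^ k * G k t))
      = -2 * (\<Sum>k\<le>n. op_coeff n k * (t ^ Suc k * G (Suc k) t
            + (real k - 1 - 2 * real n) * (t ^ k * G k t)))"
    by (rule op_coeff_sum_Suc)
  also have "(\<Sum>k\<le>n. op_coeff n k * (t ^ Suc k * G (Suc k) t
            + (real k - 1 - 2 * real n) * (t ^ k * G k t)))
      = (\<Sum>k\<le>n. op_coeff n k * ((t * (real k * t ^ (k - 1))) * G k t + t * t ^ k * G (Suc k) t)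
          - (2 * real n + 1) * (op_coeff n k * (t ^ k * G k t)))"
    unfolding tk by (intro sum.cong refl) (simp add: algebra_simps)
  also have "\<dots> = t * (\<Sum>k\<le>n. op_coeff n k * (real k * t ^ (k - 1) * G k t + t ^ k * G (Suc k) t))
      - (2 * real n + 1) * (\<Sum>k\<le>n. op_coeff n k * (t ^ k * G k t))"
    unfolding sum_subtractf sum_distrib_left by (simp add: algebra_simps)
  also have "\<dots> = - (C * real (2 * n + d) * t ^ (2 * n + 3) / r t ^ (2 * n + d + 2))"
    unfolding eq Suc.IH[OF Suc.prems] C_def[symmetric]
    by (simp add: algebra_simps eval_nat_numeral)
  finally have "(\<Sum>k\<le>Suc n. op_coeff (Suc n) k * (t ^ k * G k t))
      = 2 * C * real (2 * n + d) * t ^ (2 * n + 3) / r t ^ (2 * n + d + 2)"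
    by simp
  moreover have "4 ^ Suc n * pochhammer (real d / 2) (Suc n) = 2 * C * real (2 * n + d)"
    by (simp add: C_def pochhammer_Suc field_simps)
  moreover have "2 * Suc n + 1 = 2 * n + 3" "2 * Suc n + d = 2 * n + d + 2" by auto
  ultimately show ?case by (simp only:)
qed

section \<open>Integrability of powers of the norm\<close>

text \<open>
  On the shell \<open>2\<^sup>k\<^sup>-\<^sup>1 < norm x \<le> 2\<^sup>k\<close> the integrand is at most \<open>(2 / 2\<^sup>k) ^ (DIM('a) + 1)\<close>, while the
  enclosing ball has volume proportional to \<open>2 ^ (k * DIM('a))\<close>; the products form a convergent
  geometric series.
\<close>
lemma integrable_inverse_one_plus_norm_power:
  "integrable lborel (\<lambda>x::'a::euclidean_space. 1 / (1 + norm x) ^ (DIM('a) + 1))"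
proof (rule integrableI_bounded)
  define D where "D = DIM('a)"
  define V where "V = unit_ball_vol (real D)"
  have Vpos: "V \<ge> 0" by (simp add: V_def)
  define w :: "nat \<Rightarrow> 'a \<Rightarrow> ennreal"
    where "w k x = ennreal ((2 / 2 ^ k) ^ (D + 1)) * indicator (cball 0 (2 ^ k)) x" for k x
  show "(\<lambda>x::'a. 1 / (1 + norm x) ^ (DIM('a) + 1)) \<in> borel_measurable lborel" by measurable
  have le: "ennreal (norm (1 / (1 + norm x) ^ (DIM('a) + 1))) \<le> (\<Sum>k. w k x)" for x :: 'a
  proof -
    define k where "k = (LEAST k. norm x \<le> 2 ^ k)"
    obtain N where N: "norm x < 2 ^ N" using real_arch_pow[of 2 "norm x"] by auto
    have k: "norm x \<le> 2 ^ k" unfolding k_def by (rule LeastI[of _ N]) (use N in simp)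
    have "2 ^ k / 2 \<le> 1 + norm x"
    proof (cases k)
      case (Suc j)
      then have "\<not> norm x \<le> 2 ^ j" unfolding k_def using not_less_Least lessI by metis
      then show ?thesis using Suc by simp
    qed simp
    then have "1 / (1 + norm x) \<le> 2 / 2 ^ k" by (simp add: field_simps add_pos_nonneg)
    then have "(1 / (1 + norm x)) ^ (D + 1) \<le> (2 / 2 ^ k) ^ (D + 1)"
      by (intro power_mono) auto
    then have "ennreal (norm (1 / (1 + norm x) ^ (DIM('a) + 1))) \<le> w k x"
      using k by (simp add: w_def D_def power_divide ennreal_leI)
    also have "\<dots> \<le> (\<Sum>k. w k x)"
      using sum_le_suminf[of "\<lambda>k. w k x" "{k}"] by auto
    finally show ?thesis .
  qed
  have "(\<integral>\<^sup>+ x. ennreal (norm (1 / (1 + norm x) ^ (DIM('a) + 1))) \<partial>(lborel::'a measure))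
      \<le> (\<integral>\<^sup>+ x. (\<Sum>k. w k x) \<partial>lborel)"
    by (intro nn_integral_mono le)
  also have "\<dots> = (\<Sum>k. \<integral>\<^sup>+ x. w k x \<partial>lborel)"
    unfolding w_def by (intro nn_integral_suminf borel_measurable_times_ennreal
        borel_measurable_indicator) auto
  also have "\<dots> = (\<Sum>k. ennreal (2 ^ (D + 1) * V * (1 / 2) ^ k))"
  proof (intro suminf_cong)
    fix k
    have "(\<integral>\<^sup>+ x. w k x \<partial>lborel) = ennreal ((2 / 2 ^ k) ^ (D + 1)) * ennreal (V * (2 ^ k) ^ D)"
      by (simp add: w_def nn_integral_cmult_indicator emeasure_cball V_def D_def)
    also have "\<dots> = ennreal ((2 / 2 ^ k) ^ (D + 1) * (V * (2 ^ k) ^ D))"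
      by (rule ennreal_mult[symmetric]) (use Vpos in auto)
    also have "(2 / 2 ^ k) ^ (D + 1) * (V * (2 ^ k) ^ D) = 2 ^ (D + 1) * V * (1 / 2) ^ k"
      by (simp add: power_divide field_simps)
    finally show "(\<integral>\<^sup>+ x. w k x \<partial>lborel) = ennreal (2 ^ (D + 1) * V * (1 / 2) ^ k)" .
  qed
  also have "\<dots> < \<infinity>"
    using Vpos by (subst suminf_ennreal2) (auto intro!: summable_mult summable_geometric)
  finally show "(\<integral>\<^sup>+ x. ennreal (norm (1 / (1 + norm x) ^ (DIM('a) + 1))) \<partial>(lborel::'a measure)) < \<infinity>" .
qed

section \<open>The boundary values\<close>

text \<open>The last partial derivative is the derivative along the vertical line through \<open>x\<close>.\<close>
lemma elementary_DERIV_last: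
  fixes v :: "(real ^ 'n) \<times> real \<Rightarrow> real"
  assumes "elementary p v" "(x, t + c) \<noteq> p"
  shows "((\<lambda>t. v (x, t + c)) has_real_derivative partial_last v (x, t + c)) (at t)"
proof -
  have "((\<lambda>h. v (x, (h + t) + c)) has_real_derivative partial_last v (x, t + c)) (at 0)"
    using elementary_DERIV[OF assms, of "(0, 1)"] by (simp add: algebra_simps)
  then show ?thesis
    using DERIV_shift[of "\<lambda>t. v (x, t + c)" _ 0 t] by simp
qed

lemma norm_boundary:
  fixes x :: "real ^ 'n"
  shows "norm ((x, t - \<epsilon>) - \<epsilon> *\<^sub>R eta) = sqrt ((norm x)\<^sup>2 + t\<^sup>2)"
  by (simp add: eta_def norm_Pair)

lemma Fstar_eq:
  "Fstar d m \<epsilon> x = 2 ^ (2 * m - 2) * pochhammer (real d / 2) (m - 1) / fact m *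
     (\<epsilon> ^ (2 * m - 1) / sqrt ((norm x)\<^sup>2 + \<epsilon>\<^sup>2) ^ (2 * m + d - 2))"
  using norm_boundary[of x \<epsilon> \<epsilon>] by (simp add: Fstar_def)

text \<open>
  The cases \<open>d \<ge> 3\<close> (with \<open>\<kappa> = d - 2\<close>) and \<open>d = 2\<close> (with \<open>\<kappa> = 1\<close>) are treated together: all
  that matters about \<open>u\<close> is its first derivative \<open>du\<close>.
\<close>
lemma sum_partial_last_eq_Fstar:
  fixes u :: "(real ^ 'n) \<times> real \<Rightarrow> real" and x :: "real ^ 'n"
  assumes "elementary (\<epsilon> *\<^sub>R eta) u" "\<epsilon> > 0" "\<kappa> \<noteq> 0" "m \<ge> 1"
    and du: "\<And>y. y \<noteq> \<epsilon> *\<^sub>R eta \<Longrightarrow>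
      partial_last u y = - \<kappa> * ((y - \<epsilon> *\<^sub>R eta) \<bullet> (0, 1)) / norm (y - \<epsilon> *\<^sub>R eta) ^ d"
  shows "(\<Sum>l = 1..m. (-1) ^ l * 2 ^ (l - 1) * fact (2 * m - l - 1) /
            (fact (l - 1) * fact m * fact (m - l) * \<kappa>) * \<epsilon> ^ (l - 1) *
            (partial_last ^^ l) u (x, 0)) = Fstar d m \<epsilon> x"
proof -
  obtain n where m: "m = Suc n" using \<open>m \<ge> 1\<close> by (cases m) auto
  define G where "G k t = - (1 / \<kappa>) * (partial_last ^^ Suc k) u (x, t - \<epsilon>)" for k t
  have ne: "(x, t - \<epsilon>) \<noteq> \<epsilon> *\<^sub>R eta" if "t > 0" for t
    using that by (simp add: eta_def)
  have el: "elementary (\<epsilon> *\<^sub>R eta) ((partial_last ^^ k) u)" for k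
    by (induction k) (auto intro: elementary_partial_deriv assms)
  have dG: "(G k has_real_derivative G (Suc k) t) (at t)" if "t > 0" for k t
    using elementary_DERIV_last[OF el[of "Suc k"], of x t "- \<epsilon>"] ne[OF that]
    unfolding G_def by (intro DERIV_cmult) simp
  have G0: "G 0 t = t / sqrt ((norm x)\<^sup>2 + t\<^sup>2) ^ d" if "t > 0" for t
  proof -
    have "((x, t - \<epsilon>) - \<epsilon> *\<^sub>R eta) \<bullet> (0, 1) = t" by (simp add: eta_def inner_Pair)
    then show ?thesis
      using du[OF ne[OF that]] \<open>\<kappa> \<noteq> 0\<close> by (simp add: G_def norm_boundary)
  qed
  have shift: "(\<Sum>l = 1..m. f l) = (\<Sum>k\<le>n. f (Suc k))" for f :: "nat \<Rightarrow> real"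
    by (simp add: m sum.atLeast1_atMost_eq lessThan_Suc_atMost del: sum.cl_ivl_Suc sum.atMost_Suc)
  have "(\<Sum>l = 1..m. (-1) ^ l * 2 ^ (l - 1) * fact (2 * m - l - 1) /
            (fact (l - 1) * fact m * fact (m - l) * \<kappa>) * \<epsilon> ^ (l - 1) *
            (partial_last ^^ l) u (x, 0))
      = (\<Sum>k\<le>n. 1 / fact m * (op_coeff n k * (\<epsilon> ^ k * G k \<epsilon>)))"
    unfolding shift unfolding m
  proof (intro sum.cong refl)
    fix k assume "k \<in> {..n}"
    then have *: "2 * Suc n - Suc k - 1 = 2 * n - k" "Suc n - Suc k = n - k" "Suc k - 1 = k" "k \<le> n"
      by auto
    have **: "(-2 :: real) ^ k = (-1) ^ k * 2 ^ k"
      by (simp add: power_mult_distrib[symmetric])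
    show "(-1) ^ Suc k * 2 ^ (Suc k - 1) * fact (2 * Suc n - Suc k - 1) /
            (fact (Suc k - 1) * fact (Suc n) * fact (Suc n - Suc k) * \<kappa>) * \<epsilon> ^ (Suc k - 1) *
            (partial_last ^^ Suc k) u (x, 0)
        = 1 / fact (Suc n) * (op_coeff n k * (\<epsilon> ^ k * G k \<epsilon>))"
      unfolding * op_coeff_def G_def ** using *(4)
      by (simp del: fact_Suc add: mult_ac)
  qed
  also have "\<dots> = 1 / fact m * (\<Sum>k\<le>n. op_coeff n k * (\<epsilon> ^ k * G k \<epsilon>))"
    by (simp add: sum_distrib_left)
  also have "(\<Sum>k\<le>n. op_coeff n k * (\<epsilon> ^ k * G k \<epsilon>))
      = 4 ^ n * pochhammer (real d / 2) n * \<epsilon> ^ (2 * n + 1) / sqrt ((norm x)\<^sup>2 + \<epsilon>\<^sup>2) ^ (2 * n + d)"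
    by (rule op_coeff_derivative_identity[OF dG G0 \<open>\<epsilon> > 0\<close>])
  also have "1 / fact m * \<dots> = Fstar d m \<epsilon> x"
    unfolding Fstar_eq m by (simp add: power_mult del: fact_Suc)
  finally show ?thesis .
qed

lemma Hstar_harmonic_and_boundary:
  fixes m d :: nat and \<epsilon> :: real
  assumes "m \<ge> 1" and "d \<ge> 2" and d: "CARD('n::finite) = d - 1" and "\<epsilon> > 0"
  shows "harmonic_on (UNIV - {\<epsilon> *\<^sub>R eta}) (Hstar d m \<epsilon> :: (real ^ 'n) \<times> real \<Rightarrow> real)"
    and "Fstar d m \<epsilon> x = Hstar d m \<epsilon> (x :: real ^ 'n, 0)"
proof -
  define p :: "(real ^ 'n) \<times> real" where "p = \<epsilon> *\<^sub>R eta"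
  define \<kappa> where "\<kappa> = (if d \<ge> 3 then real d - 2 else 1)"
  define u where "u = (if d \<ge> 3 then (\<lambda>y. 1 / norm (y - p) ^ (d - 2)) else (\<lambda>y. ln (1 / norm (y - p))))"
  have dim: "DIM((real ^ 'n) \<times> real) = d" using assms by simp
  have "elementary_harmonic p (\<lambda>y. 1 / norm (y - p) ^ (d - 2))"
    by (rule elementary_harmonic_inv_norm_power) (use dim assms in simp)
  moreover have "elementary_harmonic p (\<lambda>y. ln (1 / norm (y - p)))" if "\<not> d \<ge> 3"
    by (rule elementary_harmonic_ln_norm) (use dim assms that in simp)
  ultimately have u: "elementary_harmonic p u" by (simp add: u_def)
  have H: "Hstar d m \<epsilon> = (\<lambda>y. \<Sum>l = 1..m. (-1) ^ l * 2 ^ (l - 1) * fact (2 * m - l - 1) /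
            (fact (l - 1) * fact m * fact (m - l) * \<kappa>) * \<epsilon> ^ (l - 1) *
            (partial_last ^^ l) u y)"
    by (simp add: Hstar_def fun_eq_iff u_def \<kappa>_def p_def)
  show "harmonic_on (UNIV - {\<epsilon> *\<^sub>R eta}) (Hstar d m \<epsilon> :: (real ^ 'n) \<times> real \<Rightarrow> real)"
    unfolding H p_def[symmetric]
    by (intro elementary_harmonic_imp_harmonic_on elementary_harmonic_combination
        elementary_harmonic_funpow_partial_deriv u)
  have du: "partial_last u y = - \<kappa> * ((y - p) \<bullet> (0, 1)) / norm (y - p) ^ d" if "y \<noteq> p" for y
  proof (cases "d \<ge> 3")
    case True
    then have *: "d - 2 + 2 = d" "real (d - 2) = real d - 2" by auto
    show ?thesis
      using True partial_deriv_inv_norm_power[OF that, of "(0, 1)" "d - 2", unfolded *]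
      by (simp add: u_def \<kappa>_def)
  next
    case False
    then have "d = 2" using assms by simp
    then show ?thesis
      using partial_deriv_ln_norm[OF that, of "(0, 1)"] by (simp add: u_def \<kappa>_def)
  qed
  show "Fstar d m \<epsilon> x = Hstar d m \<epsilon> (x, 0)"
    unfolding H
    by (rule sum_partial_last_eq_Fstar[symmetric])
       (use u du assms in \<open>auto simp: \<kappa>_def p_def elementary_harmonic_def\<close>)
qed

section \<open>Bounds and harmonic extension\<close>

theorem theorem6p1:
  fixes m d :: nat
  assumes "m \<ge> 1" and "d \<ge> 2" and "CARD('n::finite) = d - 1"
  shows "\<exists>c1 c2 :: real. c1 > 0 \<and> c2 > 0 \<and>
    (\<forall>\<epsilon>::real. \<epsilon> > 0 \<longrightarrow>
      (\<forall>x :: real ^ 'n. 0 < Fstar d m \<epsilon> x \<and>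
         Fstar d m \<epsilon> x \<le>
           c1 * \<epsilon> powi (- int d + 1) / (1 + inverse \<epsilon> * norm x) ^ (2 * m + d - 2)) \<and>
      (LINT x|lborel. Fstar d m \<epsilon> (x :: real ^ 'n)) \<ge> c2 \<and>
      harmonic_on (UNIV - {\<epsilon> *\<^sub>R eta}) (Hstar d m \<epsilon> :: (real ^ 'n) \<times> real \<Rightarrow> real) \<and>
      (\<forall>x :: real ^ 'n. Fstar d m \<epsilon> x = Hstar d m \<epsilon> (x, 0)))"
proof -
  define K :: real where "K = 2 ^ (2 * m - 2) * pochhammer (real d / 2) (m - 1) / fact m"
  define N where "N = 2 * m + d - 2"
  define V where "V = unit_ball_vol (real (d - 1))"
  have Kpos: "K > 0" using assms by (simp add: K_def pochhammer_pos)
  have Vpos: "V > 0" by (simp add: V_def)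
  have N: "N = (2 * m - 1) + (d - 1)" "N \<ge> d" using assms by (auto simp: N_def)
  have F: "Fstar d m \<epsilon> x = K * (\<epsilon> ^ (2 * m - 1) / sqrt ((norm x)\<^sup>2 + \<epsilon>\<^sup>2) ^ N)"
    for \<epsilon> and x :: "real ^ 'n" by (simp add: Fstar_eq K_def N_def)
  have q_lower: "(a + \<epsilon>) / 2 \<le> sqrt (a\<^sup>2 + \<epsilon>\<^sup>2)" if "a \<ge> 0" "\<epsilon> > 0" for a \<epsilon> :: real
  proof -
    define q where "q = sqrt (a\<^sup>2 + \<epsilon>\<^sup>2)"
    have "a \<le> q" "\<epsilon> \<le> q" by (auto simp: q_def)
    then have "a + \<epsilon> \<le> q + q" by (rule add_mono)
    then have "(a + \<epsilon>) / 2 \<le> q" by simp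
    then show ?thesis by (simp only: q_def)
  qed
  have upper: "Fstar d m \<epsilon> x \<le> K * 2 ^ N * \<epsilon> powi (- int d + 1) / (1 + inverse \<epsilon> * norm x) ^ N"
    if "\<epsilon> > 0" for \<epsilon> and x :: "real ^ 'n"
  proof -
    have "Fstar d m \<epsilon> x \<le> K * (\<epsilon> ^ (2 * m - 1) / ((norm x + \<epsilon>) / 2) ^ N)"
      unfolding F using Kpos that q_lower[of "norm x" \<epsilon>]
      by (intro mult_left_mono divide_left_mono power_mono mult_pos_pos zero_less_power)
         (auto intro: add_nonneg_pos add_pos_nonneg)
    also have "\<dots> = K * 2 ^ N * (\<epsilon> ^ (2 * m - 1) / (norm x + \<epsilon>) ^ N)"
      by (simp add: power_divide)
    also have "\<epsilon> ^ (2 * m - 1) = \<epsilon> powi (- int d + 1) * \<epsilon> ^ N"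
    proof -
      have "- int d + 1 = - int (d - 1)" using assms by simp
      then have "\<epsilon> powi (- int d + 1) = inverse (\<epsilon> ^ (d - 1))"
        by (simp only: power_int_minus power_int_of_nat)
      then show ?thesis using that by (simp add: N power_add)
    qed
    also have "\<epsilon> powi (- int d + 1) * \<epsilon> ^ N / (norm x + \<epsilon>) ^ N
        = \<epsilon> powi (- int d + 1) / ((norm x + \<epsilon>) / \<epsilon>) ^ N"
      by (simp add: power_divide)
    also have "(norm x + \<epsilon>) / \<epsilon> = 1 + inverse \<epsilon> * norm x"
      using that by (simp add: field_simps)
    finally show ?thesis by simp
  qed
  have positive: "0 < Fstar d m \<epsilon> x" if "\<epsilon> > 0" for \<epsilon> and x :: "real ^ 'n"
    unfolding F using Kpos that by (intro mult_pos_pos divide_pos_pos zero_less_power) (auto intro: add_nonneg_pos)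
  have lower: "K / 2 ^ N * V \<le> (LINT x|lborel. Fstar d m \<epsilon> (x :: real ^ 'n))" if "\<epsilon> > 0" for \<epsilon>
  proof -
    \<comment> \<open>Any \<open>\<delta>\<close> with \<open>\<delta> * (1 + norm x) \<le> (norm x + \<epsilon>) / 2\<close> will do; it need not be uniform in \<open>\<epsilon>\<close>,
      as it serves integrability only.\<close>
    define \<delta> where "\<delta> = min 1 \<epsilon> / 2"
    have \<delta>: "\<delta> > 0" using that by (simp add: \<delta>_def)
    have dim: "DIM(real ^ 'n) + 1 = d" using assms by simp
    have int: "integrable lborel (\<lambda>x :: real ^ 'n. Fstar d m \<epsilon> x)"
    proof (rule Bochner_Integration.integrable_bound)
      show "integrable lborel
        (\<lambda>x :: real ^ 'n. K * \<epsilon> ^ (2 * m - 1) / \<delta> ^ N * (1 / (1 + norm x) ^ d))"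
        using integrable_inverse_one_plus_norm_power[where 'a = "real ^ 'n"]
        unfolding dim by (rule integrable_mult_right)
      show "(\<lambda>x :: real ^ 'n. Fstar d m \<epsilon> x) \<in> borel_measurable lborel"
        unfolding F by measurable
      have "norm (Fstar d m \<epsilon> x) \<le> norm (K * \<epsilon> ^ (2 * m - 1) / \<delta> ^ N * (1 / (1 + norm x) ^ d))"
        for x :: "real ^ 'n"
      proof -
        have "\<delta> * norm x \<le> 1 / 2 * norm x" by (intro mult_right_mono) (auto simp: \<delta>_def)
        then have "\<delta> * (1 + norm x) \<le> (norm x + \<epsilon>) / 2"
          by (auto simp: \<delta>_def algebra_simps min_def split: if_splits)
        also have "\<dots> \<le> sqrt ((norm x)\<^sup>2 + \<epsilon>\<^sup>2)" using q_lower that by simp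
        finally have "(\<delta> * (1 + norm x)) ^ N \<le> sqrt ((norm x)\<^sup>2 + \<epsilon>\<^sup>2) ^ N"
          using \<delta> by (intro power_mono) auto
        moreover have "\<delta> ^ N * (1 + norm x) ^ d \<le> (\<delta> * (1 + norm x)) ^ N"
          unfolding power_mult_distrib using \<delta> N by (intro mult_left_mono power_increasing) auto
        ultimately have "\<delta> ^ N * (1 + norm x) ^ d \<le> sqrt ((norm x)\<^sup>2 + \<epsilon>\<^sup>2) ^ N" by simp
        then have "Fstar d m \<epsilon> x \<le> K * (\<epsilon> ^ (2 * m - 1) / (\<delta> ^ N * (1 + norm x) ^ d))"
          unfolding F using Kpos that \<delta>
          by (intro mult_left_mono divide_left_mono mult_pos_pos zero_less_power)
             (auto intro: add_nonneg_pos add_pos_nonneg)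
        also have "\<dots> = K * \<epsilon> ^ (2 * m - 1) / \<delta> ^ N * (1 / (1 + norm x) ^ d)" by simp
        finally have "Fstar d m \<epsilon> x \<le> \<dots>" .
        moreover have "norm (Fstar d m \<epsilon> x) = Fstar d m \<epsilon> x" using positive[OF that, of x] by simp
        ultimately show ?thesis unfolding real_norm_def by linarith
      qed
      then show "AE x :: real ^ 'n in lborel. norm (Fstar d m \<epsilon> x)
          \<le> norm (K * \<epsilon> ^ (2 * m - 1) / \<delta> ^ N * (1 / (1 + norm x) ^ d))" by simp
    qed
    \<comment> \<open>The lower bound of \<open>Fstar\<close> on the ball of radius \<open>\<epsilon>\<close>, where the root is at most \<open>2 * \<epsilon>\<close>.\<close>
    define c where "c = K * (\<epsilon> ^ (2 * m - 1) / (2 * \<epsilon>) ^ N)"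
    have "K / 2 ^ N * V = c * (V * \<epsilon> ^ (d - 1))"
      using that by (simp add: c_def N(1) power_add power_mult_distrib)
    also have "\<dots> = (LINT x|lborel. c * indicator (cball (0 :: real ^ 'n) \<epsilon>) x)"
      using that assms by (simp add: content_cball V_def)
    also have "\<dots> \<le> (LINT x|lborel. Fstar d m \<epsilon> (x :: real ^ 'n))"
    proof (rule integral_mono[OF _ int])
      show "integrable lborel (\<lambda>x. c * indicator (cball (0 :: real ^ 'n) \<epsilon>) x)"
        by (intro integrable_mult_right integrable_real_indicator) (use emeasure_lborel_cball_finite in \<open>auto simp: less_top\<close>)
      fix x :: "real ^ 'n"
      have "c \<le> Fstar d m \<epsilon> x" if "norm x \<le> \<epsilon>"
      proof -
        have "sqrt ((norm x)\<^sup>2 + \<epsilon>\<^sup>2) \<le> norm x + \<epsilon>"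
          using \<open>\<epsilon> > 0\<close> by (intro sqrt_sum_squares_le_sum) auto
        then have "sqrt ((norm x)\<^sup>2 + \<epsilon>\<^sup>2) \<le> 2 * \<epsilon>" using that by simp
        then show ?thesis
          unfolding F c_def using Kpos \<open>\<epsilon> > 0\<close>
          by (intro mult_left_mono divide_left_mono power_mono mult_pos_pos zero_less_power)
             (auto intro: add_nonneg_pos)
      qed
      then show "c * indicator (cball 0 \<epsilon>) x \<le> Fstar d m \<epsilon> x"
        using positive[OF \<open>\<epsilon> > 0\<close>, of x] by (auto simp: indicator_def)
    qed
    finally show ?thesis .
  qed
  show ?thesis
  proof (intro exI conjI allI impI)
    show "K * 2 ^ N > 0" "K / 2 ^ N * V > 0" using Kpos Vpos by auto
  qed (use positive upper lower Hstar_harmonic_and_boundary[OF assms] in \<open>auto simp: N_def\<close>)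
qed

end
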